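(* For every $n\geq 2$, $\kappa^s(BH_n;K_{1,1})=2n$.
   Context: The $n$-dimensional balanced hypercube $BH_n$ is the graph with vertex set $\{0,1,2,3\}^n$, vertices written $(a_0,a_1,\dots,a_{n-1})$, in which $(a_0,\dots,a_{n-1})$ is adjacent exactly to the $2n$ vertices $((a_0\pm 1)\bmod 4,a_1,\dots,a_{n-1})$ and, for each $1\le i\le n-1$, $((a_0\pm1)\bmod 4,a_1,\dots,a_{i-1},(a_i+(-1)^{a_0})\bmod 4,a_{i+1},\dots,a_{n-1})$. For a connected graph $G$ and a set $F$ of connected subgraphs of $G$, let $V(F)$ be the union of their vertex sets; $F$ is a subgraph-cut if $G-V(F)$ is disconnected or trivial. For a connected subgraph $H$ of $G$, an $H$-substructure-cut is a subgraph-cut each of whose elements is isomorphic to a connected subgraph of $H$, and $\kappa^s(G;H)$ is the minimum cardinality of an $H$-substructure-cut. $K_{1,1}$ is the graph consisting of a single edge. *)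

theory Defs
  imports "Graph_Theory.Graph_Theory" "HOL-Library.Extended_Nat"
begin

text \<open>
  Undirected graphs are symmetric digraphs, so an undirected subgraph has to be symmetric itself:
  this is what \<open>graph K\<close> adds to \<open>subgraph K G\<close>. The library's \<open>connected\<close> includes nonemptiness.
\<close>

definition connected_subgraph :: "('a, 'b) pre_digraph \<Rightarrow> ('a, 'b) pre_digraph \<Rightarrow> bool" where
  "connected_subgraph K G \<longleftrightarrow> graph K \<and> subgraph K G \<and> connected K"

definition subgraph_cut :: "('a, 'b) pre_digraph \<Rightarrow> ('a, 'b) pre_digraph set \<Rightarrow> bool" where
  "subgraph_cut G F \<longleftrightarrow>
     (\<forall>K\<in>F. connected_subgraph K G) \<and>
     (let R = G \<restriction> (verts G - (\<Union>K\<in>F. verts K))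
      in \<not> connected R \<or> (\<exists>v. verts R = {v}))"

definition substructure_cut ::
    "('a, 'b) pre_digraph \<Rightarrow> ('c, 'd) pre_digraph \<Rightarrow> ('a, 'b) pre_digraph set \<Rightarrow> bool" where
  "substructure_cut G H F \<longleftrightarrow>
     subgraph_cut G F \<and> (\<forall>K\<in>F. \<exists>K'. connected_subgraph K' H \<and> digraph_iso K K')"

text \<open>If \<open>G\<close> is finite, every set of subgraphs of \<open>G\<close> is finite.\<close>

definition substructure_connectivity ::
    "('a, 'b) pre_digraph \<Rightarrow> ('c, 'd) pre_digraph \<Rightarrow> enat" (\<open>\<kappa>\<^sup>s\<close>) where
  "\<kappa>\<^sup>s G H = Inf {enat (card F) | F. finite F \<and> substructure_cut G H F}"

definition BH_verts :: "nat \<Rightarrow> int list set" where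
  "BH_verts n = {a. length a = n \<and> set a \<subseteq> {0, 1, 2, 3}}"

definition BH_nbrs :: "nat \<Rightarrow> int list \<Rightarrow> int list set" where
  "BH_nbrs n a =
     {a[0 := (a ! 0 + s) mod 4] | s. s \<in> {1, -1}} \<union>
     {a[0 := (a ! 0 + s) mod 4, i := (a ! i + (-1) ^ nat (a ! 0)) mod 4] | s i.
        s \<in> {1, -1} \<and> 1 \<le> i \<and> i \<le> n - 1}"

text \<open>The balanced hypercube; meaningful for dimension at least 1.\<close>

definition BH :: "nat \<Rightarrow> int list pair_pre_digraph" where
  "BH n = \<lparr> pverts = BH_verts n, parcs = {(a, b). a \<in> BH_verts n \<and> b \<in> BH_nbrs n a} \<rparr>"

end

theory Submission
  imports Defs "HOL-Library.Numeral_Type"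
begin

text \<open>
  Two vertices of \<open>BH\<^sub>n\<close> that differ by 2 in coordinate 0 have the same neighbours. Identifying
  such twins leaves an \<open>n\<close>-regular bipartite graph on (parity of coordinate 0) \<open>\<times> \<int>\<^sub>4\<^sup>n\<^sup>-\<^sup>1\<close>, in
  which an even class \<open>x\<close> is joined to the odd classes \<open>x\<close> and \<open>x + e\<^sub>i\<close>. Removed edges and vertices
  of \<open>BH\<^sub>n\<close> become cliques of this quotient, and a class is wiped out only if two of them meet it. As
  a clique meets an independent set at most once, wiping out \<open>m\<close> independent classes takes \<open>2m\<close>
  cliques.

  Fewer than \<open>2n\<close> cliques do not disconnect the quotient, by induction on \<open>n\<close>. One coordinate in
  \<open>\<int>\<^sub>4\<close> splits the quotient into a cycle of four layers, each a quotient of dimension \<open>n - 1\<close>. If every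
  layer meets at most \<open>2n - 3\<close> cliques, the layers stay connected and counting leaves an edge between
  consecutive ones. Otherwise at most one clique misses some layer \<open>c\<close>, so every class wiped out
  outside this layer has a neighbour in it. Hence the opposite layer is intact and is reached from both
  layers next to it. From a class of layer \<open>c\<close> there are \<open>n\<close> ways out, one direct and \<open>n - 1\<close>
  through a neighbour in the layer; classes that block all of them are independent, so this takes
  \<open>2n\<close> cliques. Conversely, removing the \<open>2n\<close> neighbours of a vertex separates it from its twin.
\<close>

subsection \<open>Vertex sets covered twice by cliques\<close>

definition mutually_reachable :: "'v rel \<Rightarrow> 'v set \<Rightarrow> bool" where
  "mutually_reachable E S \<longleftrightarrow> (\<forall>u\<in>S. \<forall>v\<in>S. (u, v) \<in> (Restr E S)\<^sup>*)"

text \<open>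
  The cliques are indexed because different removed subgraphs may become equal in the quotient.
\<close>

locale double_clique_cover =
  fixes E :: "'v rel" and I :: "'i set" and K :: "'i \<Rightarrow> 'v set" and B :: "'v set"
  assumes finite_index: "finite I"
    and clique: "\<lbrakk>i \<in> I; u \<in> K i; v \<in> K i; u \<noteq> v\<rbrakk> \<Longrightarrow> (u, v) \<in> E"
    and covered_twice: "v \<in> B \<Longrightarrow> 2 \<le> card {i \<in> I. v \<in> K i}"
begin

definition meeting :: "'v set \<Rightarrow> 'i set" where
  "meeting A = {i \<in> I. K i \<inter> A \<noteq> {}}"

lemma finite_meeting [simp]: "finite (meeting A)"
  using finite_index by (simp add: meeting_def)

lemma card_meeting_mono: "A \<subseteq> C \<Longrightarrow> card (meeting A) \<le> card (meeting C)"
  by (rule card_mono[OF finite_meeting]) (auto simp: meeting_def)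

lemma card_meeting_le: "card (meeting A) \<le> card I"
  using finite_index by (intro card_mono) (auto simp: meeting_def)

lemma card_independent_le:
  assumes "A \<subseteq> B" and "\<And>u v. \<lbrakk>u \<in> A; v \<in> A; u \<noteq> v\<rbrakk> \<Longrightarrow> (u, v) \<notin> E"
  shows "2 * card A \<le> card (meeting A)"
proof (cases "finite A")
  case True
  have "2 * card A = (\<Sum>v\<in>A. 2)" by simp
  also have "\<dots> \<le> (\<Sum>v\<in>A. card {i \<in> I. v \<in> K i})"
    using assms(1) covered_twice by (intro sum_mono) auto
  also have "\<dots> = card (\<Union>v\<in>A. {i \<in> I. v \<in> K i})"
  proof (rule card_UN_disjoint[symmetric])
    show "\<forall>v\<in>A. \<forall>w\<in>A. v \<noteq> w \<longrightarrow> {i \<in> I. v \<in> K i} \<inter> {i \<in> I. w \<in> K i} = {}"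
      using assms(2) clique by blast
  qed (use True finite_index in auto)
  also have "(\<Union>v\<in>A. {i \<in> I. v \<in> K i}) = meeting A"
    by (auto simp: meeting_def)
  finally show ?thesis .
qed simp

lemma covered_empty:
  assumes "card I \<le> 1"
  shows "B = {}"
proof (rule ccontr)
  assume "B \<noteq> {}"
  then obtain v where "v \<in> B" by blast
  then have "2 * card {v} \<le> card (meeting {v})" by (intro card_independent_le) auto
  also have "\<dots> \<le> card I" by (rule card_meeting_le)
  finally show False using assms by simp
qed

lemma double_clique_cover_vimage:
  assumes embedding: "\<And>u v. (f u, f v) \<in> E \<longleftrightarrow> (u, v) \<in> E'" and "inj f"
  shows "double_clique_cover E' (meeting (range f)) (\<lambda>i. f -` K i) (f -` B)"
proof
  show "(u, v) \<in> E'"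
    if "i \<in> meeting (range f)" "u \<in> f -` K i" "v \<in> f -` K i" "u \<noteq> v" for i u v
    using that embedding \<open>inj f\<close> clique[of i "f u" "f v"] by (auto simp: meeting_def inj_eq)
  show "2 \<le> card {i \<in> meeting (range f). v \<in> f -` K i}" if "v \<in> f -` B" for v
  proof -
    have "{i \<in> meeting (range f). v \<in> f -` K i} = {i \<in> I. f v \<in> K i}"
      by (auto simp: meeting_def)
    then show ?thesis using covered_twice[of "f v"] that by simp
  qed
qed simp

end


subsection \<open>The quotient by twins\<close>

lemma exhaust_Z4: "c \<in> {0, 1, 2, 3 :: 4}"
proof (cases c)
  case (of_int z)
  then have "z \<in> {0, 1, 2, 3}" by auto
  with of_int show ?thesis by auto
qed

definition shift :: "bool \<Rightarrow> 4 \<Rightarrow> 4" where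
  "shift p c = (if p then c + 1 else c - 1)"

lemma shift_neq [simp]: "shift p c \<noteq> c" "c \<noteq> shift p c"
  by (auto simp: shift_def)

lemma shift_neq_shift_not [simp]: "shift p c \<noteq> shift (\<not> p) c" "shift (\<not> p) c \<noteq> shift p c"
  by (auto simp: shift_def)

lemma shift_shift_not [simp]: "shift p (shift (\<not> p) c) = c" "shift (\<not> p) (shift p c) = c"
  by (simp_all add: shift_def)

lemma shift_twice [simp]: "shift p (shift p c) = c + 2"
  using exhaust_Z4[of c] by (auto simp: shift_def)

lemma shift_opposite_neq [simp]: "shift p (c + 2) \<noteq> c"
  using exhaust_Z4[of c] by (auto simp: shift_def)

lemma Z4_cases:
  fixes c d :: 4
  obtains (same) "d = c" | (opposite) "d = c + 2" | (adjacent) p where "d = shift p c"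
proof -
  have "d - c \<in> {0, 1, 2, 3}" by (rule exhaust_Z4)
  then have "d - c = 0 \<or> d - c = 2 \<or> d - c = 1 \<or> d - c = - 1" by auto
  then show ?thesis
    using same opposite adjacent[of True] adjacent[of False]
    by (auto simp: shift_def diff_eq_eq add.commute)
qed

text \<open>The Boolean tells whether coordinate 0 is even.\<close>

type_synonym twin_class = "bool \<times> 4 list"

definition twin_classes :: "nat \<Rightarrow> twin_class set" where
  "twin_classes k = {(p, x). length x = k}"

primrec lazy_step :: "bool \<Rightarrow> 4 list \<Rightarrow> 4 list \<Rightarrow> bool" where
  "lazy_step p [] y \<longleftrightarrow> y = []"
| "lazy_step p (c # x) y \<longleftrightarrow> y = shift p c # x \<or> (\<exists>z. y = c # z \<and> lazy_step p x z)"

definition twin_adj :: "twin_class rel" where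
  "twin_adj = {((p, x), (q, y)). q = (\<not> p) \<and> lazy_step p x y}"

lemma twin_classes_iff [simp]: "(p, x) \<in> twin_classes k \<longleftrightarrow> length x = k"
  by (simp add: twin_classes_def)

lemma lazy_step_refl: "lazy_step p x x"
  by (induction x) auto

lemma lazy_step_sym: "lazy_step p x y \<Longrightarrow> lazy_step (\<not> p) y x"
  by (induction x arbitrary: y) auto

lemma length_lazy_step: "lazy_step p x y \<Longrightarrow> length y = length x"
  by (induction x arbitrary: y) auto

lemma lazy_step_set_Cons:
  "{y. lazy_step p (c # x) y} = insert (shift p c # x) ((#) c ` {y. lazy_step p x y})"
  by auto

lemma finite_lazy_step [simp]: "finite {y. lazy_step p x y}"
  by (induction x) (simp_all only: lazy_step_set_Cons, simp_all)

lemma card_lazy_step [simp]: "card {y. lazy_step p x y} = Suc (length x)"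
proof (induction x)
  case (Cons c x)
  then show ?case by (simp only: lazy_step_set_Cons) (simp add: card_image image_iff)
qed simp

lemma sym_twin_adj: "sym twin_adj"
  using lazy_step_sym by (fastforce simp: sym_def twin_adj_def)

lemma twin_adj_Cons [simp]:
  "((p, c # x), (q, d # y)) \<in> twin_adj \<longleftrightarrow>
     c = d \<and> ((p, x), (q, y)) \<in> twin_adj \<or> d = shift p c \<and> q = (\<not> p) \<and> x = y"
  by (auto simp: twin_adj_def)

lemma twin_adj_same_parity [simp]: "((p, x), (p, y)) \<notin> twin_adj"
  by (simp add: twin_adj_def)

lemma twin_adj_irrefl [simp]: "(C, C) \<notin> twin_adj"
  by (cases C) simp

definition layer :: "4 \<Rightarrow> twin_class set" where
  "layer c = {(p, c # x) | p x. True}"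

lemma layer_iff [simp]: "(p, x) \<in> layer c \<longleftrightarrow> (\<exists>y. x = c # y)"
  by (auto simp: layer_def)

lemma layer_eq_range: "layer c = range (apsnd ((#) c))"
  by (auto simp: layer_def image_iff)


subsection \<open>Connectivity of the quotient\<close>

locale layered_double_cover = double_clique_cover twin_adj I K B
  for I :: "'i set" and K :: "'i \<Rightarrow> twin_class set" and B +
  fixes k :: nat
  assumes card_index_le: "card I \<le> 2 * k + 3"
    and layer_reachable: "card (meeting (layer c)) \<le> 2 * k + 1 \<Longrightarrow>
      mutually_reachable twin_adj (twin_classes k - apsnd ((#) c) -` B)"
begin

definition crowded :: "4 \<Rightarrow> bool" where
  "crowded c \<longleftrightarrow> 2 * k + 1 < card (meeting (layer c))"

definition unblocked :: "twin_class set" where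
  "unblocked = twin_classes (Suc k) - B"

abbreviation joined :: "twin_class \<Rightarrow> twin_class \<Rightarrow> bool" (infix \<open>\<leadsto>\<close> 50) where
  "u \<leadsto> v \<equiv> (u, v) \<in> (Restr twin_adj unblocked)\<^sup>*"

lemma unblocked_iff: "(p, c # x) \<in> unblocked \<longleftrightarrow> length x = k \<and> (p, c # x) \<notin> B"
  by (auto simp: unblocked_def)

lemma unblocked_cases:
  assumes "u \<in> unblocked"
  obtains p c x where "u = (p, c # x)" "length x = k"
  using assms by (cases u) (auto simp: unblocked_def length_Suc_conv)

lemma joined_sym:
  assumes "u \<leadsto> v"
  shows "v \<leadsto> u"
proof -
  have "sym (Restr twin_adj unblocked)"
    using sym_twin_adj by (blast intro: symI dest: symD)
  then show ?thesis using assms by (blast intro: symD sym_rtrancl)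
qed

lemma joined_if_adj: "\<lbrakk>u \<in> unblocked; v \<in> unblocked; (u, v) \<in> twin_adj\<rbrakk> \<Longrightarrow> u \<leadsto> v"
  by auto

lemma joined_in_layer:
  assumes "\<not> crowded c" and "(p, c # x) \<in> unblocked" "(q, c # y) \<in> unblocked"
  shows "(p, c # x) \<leadsto> (q, c # y)"
proof -
  let ?S = "twin_classes k - apsnd ((#) c) -` B"
  have "mutually_reachable twin_adj ?S"
    using assms(1) by (intro layer_reachable) (simp add: crowded_def)
  then have "((p, x), (q, y)) \<in> (Restr twin_adj ?S)\<^sup>*"
    using assms(2,3) by (auto simp: mutually_reachable_def unblocked_iff)
  then have "apsnd ((#) c) (p, x) \<leadsto> apsnd ((#) c) (q, y)"
  proof (induction rule: rtrancl_induct)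
    case (step v w)
    then have "(apsnd ((#) c) v, apsnd ((#) c) w) \<in> Restr twin_adj unblocked"
      by (cases v; cases w) (auto simp: unblocked_iff)
    with step.IH show ?case by (rule rtrancl_into_rtrancl)
  qed simp
  then show ?thesis by simp
qed

lemma mutually_reachable_if_all_joined_to_layer:
  assumes "\<not> crowded d"
    and to_layer: "\<And>u. u \<in> unblocked \<Longrightarrow> \<exists>v\<in>unblocked \<inter> layer d. u \<leadsto> v"
  shows "mutually_reachable twin_adj unblocked"
  unfolding mutually_reachable_def
proof (intro ballI)
  fix u v assume "u \<in> unblocked" "v \<in> unblocked"
  then obtain u' v' where "u' \<in> unblocked \<inter> layer d" "v' \<in> unblocked \<inter> layer d"
    and joined: "u \<leadsto> u'" "v \<leadsto> v'"
    using to_layer by meson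
  then have "u' \<leadsto> v'"
    using joined_in_layer[OF assms(1)] by (auto simp: layer_def)
  with joined show "u \<leadsto> v"
    using joined_sym by (meson rtrancl_trans)
qed

lemma card_index_ge_if_exits_blocked:
  assumes "length x = k" and cross: "(\<not> p, shift p c # x) \<in> B"
    and via: "\<And>y. lazy_step p x y \<Longrightarrow> (\<not> p, c # y) \<in> B \<or> (p, shift (\<not> p) c # y) \<in> B"
  shows "2 * (k + 2) \<le> card I"
proof -
  define Y where "Y = {y. lazy_step p x y}"
  \<comment> \<open>the first class of \<open>B\<close> on the way out through \<open>y\<close>\<close>
  define block where "block y =
    (if (\<not> p, c # y) \<in> B then (\<not> p, c # y) else (p, shift (\<not> p) c # y))" for y
  let ?A = "insert (\<not> p, shift p c # x) (block ` Y)"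
  have "2 * card ?A \<le> card (meeting ?A)"
  proof (rule card_independent_le)
    show "?A \<subseteq> B" using cross via by (auto simp: block_def Y_def)
    show "(v, w) \<notin> twin_adj" if "v \<in> ?A" "w \<in> ?A" for v w
      using that by (auto simp: block_def split: if_splits)
  qed
  also have "\<dots> \<le> card I" by (rule card_meeting_le)
  finally have "2 * card ?A \<le> card I" .
  moreover have "inj_on block Y"
    by (auto simp: inj_on_def block_def split: if_splits)
  then have "card (block ` Y) = Suc k" "finite (block ` Y)"
    using \<open>length x = k\<close> by (simp_all add: Y_def card_image)
  moreover have "(\<not> p, shift p c # x) \<notin> block ` Y"
    by (auto simp: block_def split: if_splits)
  ultimately show ?thesis by simp
qed

lemma joined_outside_layer:
  assumes unblocked: "u \<in> unblocked"
  shows "\<exists>v\<in>unblocked - layer c. u \<leadsto> v"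
proof (rule ccontr)
  assume confined: "\<not> ?thesis"
  then have "u \<in> layer c" using unblocked by blast
  then obtain p x where u_eq: "u = (p, c # x)" by (auto simp: layer_def)
  have length_x: "length x = k" using unblocked by (simp add: u_eq unblocked_iff)
  have "2 * (k + 2) \<le> card I"
  proof (rule card_index_ge_if_exits_blocked[OF length_x])
    show "(\<not> p, shift p c # x) \<in> B"
    proof (rule ccontr)
      assume "\<not> ?thesis"
      then have cross: "(\<not> p, shift p c # x) \<in> unblocked"
        using length_x by (simp add: unblocked_iff)
      then have "u \<leadsto> (\<not> p, shift p c # x)"
        using unblocked by (intro joined_if_adj) (auto simp: u_eq)
      moreover have "(\<not> p, shift p c # x) \<notin> layer c" by simp
      ultimately show False using confined cross by blast
    qed
    show "(\<not> p, c # y) \<in> B \<or> (p, shift (\<not> p) c # y) \<in> B" if "lazy_step p x y" for y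
    proof (rule ccontr)
      assume "\<not> ?thesis"
      then have via: "(\<not> p, c # y) \<in> unblocked" "(p, shift (\<not> p) c # y) \<in> unblocked"
        using length_lazy_step[OF that] length_x by (auto simp: unblocked_iff)
      have "u \<leadsto> (\<not> p, c # y)"
        using unblocked via that by (intro joined_if_adj) (auto simp: u_eq twin_adj_def)
      also have "(\<not> p, c # y) \<leadsto> (p, shift (\<not> p) c # y)"
        using via by (intro joined_if_adj) auto
      finally have "u \<leadsto> (p, shift (\<not> p) c # y)" .
      moreover have "(p, shift (\<not> p) c # y) \<notin> layer c" by simp
      ultimately show False using confined via(2) by blast
    qed
  qed
  then show False using card_index_le by simp
qed

lemma not_blocked_if_not_adj_to_crowded_layer:
  assumes "crowded c" and "d \<noteq> c" "shift p d \<noteq> c"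
  shows "(p, d # x) \<notin> B" (is "?v \<notin> B")
proof
  assume "?v \<in> B"
  have "(?v, w) \<notin> twin_adj" "?v \<noteq> w" if "w \<in> layer c" for w
    using that assms(2,3) by (auto simp: layer_def)
  then have "{i \<in> I. ?v \<in> K i} \<subseteq> I - meeting (layer c)"
    using clique unfolding meeting_def by blast
  then have "card {i \<in> I. ?v \<in> K i} \<le> card (I - meeting (layer c))"
    using finite_index by (intro card_mono) auto
  also have "\<dots> = card I - card (meeting (layer c))"
    by (rule card_Diff_subset[OF finite_meeting]) (auto simp: meeting_def)
  finally show False
    using covered_twice[OF \<open>?v \<in> B\<close>] \<open>crowded c\<close> card_index_le by (simp add: crowded_def)
qed

lemma joined_opposite_layer_outside_crowded:
  assumes "crowded c" and unblocked: "(p, d # x) \<in> unblocked" and "d \<noteq> c"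
  shows "\<exists>w\<in>unblocked \<inter> layer (c + 2). (p, d # x) \<leadsto> w"
proof -
  note not_blocked = not_blocked_if_not_adj_to_crowded_layer[OF \<open>crowded c\<close>]
  have via_cross: "\<exists>w\<in>unblocked \<inter> layer (c + 2). (q, shift q c # x) \<leadsto> w"
    if "(q, shift q c # x) \<in> unblocked" for q
  proof -
    have "(\<not> q, (c + 2) # x) \<in> unblocked"
      using that not_blocked by (simp add: unblocked_iff)
    moreover from this that have "(q, shift q c # x) \<leadsto> (\<not> q, (c + 2) # x)"
      by (intro joined_if_adj) auto
    ultimately show ?thesis by fastforce
  qed
  show ?thesis
  proof (cases rule: Z4_cases[of d c])
    case opposite
    then show ?thesis using unblocked by (intro bexI[of _ "(p, d # x)"]) auto
  next
    case (adjacent q)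
    then have vertical: "(q, d # x) \<in> unblocked"
      using unblocked not_blocked by (simp add: unblocked_iff)
    have "(p, d # x) \<leadsto> (q, d # x)"
      using unblocked vertical by (cases "p = q") (auto intro!: joined_if_adj simp: twin_adj_def lazy_step_refl)
    then show ?thesis using via_cross vertical adjacent by (meson rtrancl_trans)
  qed (use \<open>d \<noteq> c\<close> in simp)
qed

lemma joined_opposite_layer_if_crowded:
  assumes "crowded c" and "u \<in> unblocked"
  shows "\<exists>w\<in>unblocked \<inter> layer (c + 2). u \<leadsto> w"
proof -
  obtain v where outside: "v \<in> unblocked" "v \<notin> layer c" "u \<leadsto> v"
    using assms(2) joined_outside_layer by blast
  then obtain p d x where "v = (p, d # x)" "d \<noteq> c"
    by (auto elim: unblocked_cases)
  with outside show ?thesis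
    using joined_opposite_layer_outside_crowded[OF assms(1), of p d x] by (meson rtrancl_trans)
qed

lemma mutually_reachable_if_crowded:
  assumes "crowded c"
  shows "mutually_reachable twin_adj unblocked"
proof (rule mutually_reachable_if_all_joined_to_layer)
  have "meeting (layer c) \<inter> meeting (layer (c + 2)) = {}"
  proof (rule ccontr)
    assume "\<not> ?thesis"
    then obtain i p x q y where "i \<in> I" "(p, c # x) \<in> K i" "(q, (c + 2) # y) \<in> K i"
      by (auto simp: meeting_def layer_def)
    then have "((p, c # x), (q, (c + 2) # y)) \<in> twin_adj" by (intro clique) auto
    then show False by (auto simp: shift_def)
  qed
  then have "card (meeting (layer c)) + card (meeting (layer (c + 2))) =
      card (meeting (layer c) \<union> meeting (layer (c + 2)))"
    by (intro card_Un_disjoint[symmetric]) auto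
  also have "\<dots> \<le> card I"
    using finite_index by (intro card_mono) (auto simp: meeting_def)
  finally show "\<not> crowded (c + 2)"
    using \<open>crowded c\<close> card_index_le by (simp add: crowded_def)
qed (rule joined_opposite_layer_if_crowded[OF \<open>crowded c\<close>])

lemma card_blocked_in_layer_le:
  assumes "\<not> crowded c"
  shows "card {x. length x = k \<and> (p, c # x) \<in> B} \<le> k"
proof -
  let ?X = "{x. length x = k \<and> (p, c # x) \<in> B}" and ?f = "\<lambda>x. (p, c # x)"
  have "2 * card (?f ` ?X) \<le> card (meeting (?f ` ?X))"
    by (rule card_independent_le) auto
  also have "\<dots> \<le> card (meeting (layer c))"
    by (rule card_meeting_mono) auto
  also have "\<dots> \<le> 2 * k + 1" using assms by (simp add: crowded_def)
  finally show ?thesis by (simp add: card_image inj_on_def)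
qed

lemma joined_next_layer:
  assumes spread: "\<And>d. \<not> crowded d" and "u \<in> unblocked \<inter> layer c"
  shows "\<exists>v\<in>unblocked \<inter> layer (c + 1). u \<leadsto> v"
proof -
  obtain p x where u_eq: "u = (p, c # x)" "(p, c # x) \<in> unblocked"
    using assms(2) by (auto simp: layer_def)
  let ?L = "{y :: 4 list. length y = k}"
  let ?X = "{y. length y = k \<and> (True, c # y) \<in> B}"
  let ?Y = "{y. length y = k \<and> (False, (c + 1) # y) \<in> B}"
  have lists: "finite ?L" "card ?L = 4 ^ k"
    using finite_lists_length_eq[of "UNIV :: 4 set" k] card_lists_length_eq[of "UNIV :: 4 set" k]
    by simp_all
  have "card (?X \<union> ?Y) \<le> card ?X + card ?Y" by (rule card_Un_le)
  also have "\<dots> \<le> 2 * k"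
    using card_blocked_in_layer_le[OF spread] by (simp add: add_mono mult_2)
  also have "\<dots> < 4 ^ k" by (induction k) auto
  finally have "?X \<union> ?Y \<noteq> ?L" using lists by auto
  then obtain y where "length y = k" "(True, c # y) \<notin> B" "(False, (c + 1) # y) \<notin> B"
    by blast
  then have edge: "(True, c # y) \<in> unblocked" "(False, (c + 1) # y) \<in> unblocked \<inter> layer (c + 1)"
    by (simp_all add: unblocked_iff)
  have "u \<leadsto> (True, c # y)"
    using joined_in_layer[OF spread] u_eq edge by simp
  also have "(True, c # y) \<leadsto> (False, (c + 1) # y)"
    using edge by (intro joined_if_adj) (auto simp: shift_def)
  finally show ?thesis using edge(2) by blast
qed

lemma mutually_reachable_if_spread:
  assumes spread: "\<And>c. \<not> crowded c"
  shows "mutually_reachable twin_adj unblocked"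
proof (rule mutually_reachable_if_all_joined_to_layer[OF spread])
  have advance: "\<exists>v\<in>unblocked \<inter> layer (c + of_nat n). u \<leadsto> v"
    if "u \<in> unblocked \<inter> layer c" for u c n
  proof (induction n)
    case 0
    then show ?case using that by auto
  next
    case (Suc n)
    then obtain v where joined: "v \<in> unblocked \<inter> layer (c + of_nat n)" "u \<leadsto> v" by blast
    then obtain w where "w \<in> unblocked \<inter> layer (c + of_nat n + 1)" "v \<leadsto> w"
      using joined_next_layer[OF spread] by blast
    with joined(2) show ?case
      by (intro bexI[of _ w]) (auto simp: ac_simps intro: rtrancl_trans)
  qed
  fix u assume "u \<in> unblocked"
  then obtain c where in_layer: "u \<in> unblocked \<inter> layer c"
    by (auto elim: unblocked_cases)
  have "c + of_nat 0 = 0 \<or> c + of_nat 1 = 0 \<or> c + of_nat 2 = 0 \<or> c + of_nat 3 = 0"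
    using exhaust_Z4[of c] by auto
  then show "\<exists>v\<in>unblocked \<inter> layer 0. u \<leadsto> v"
    using advance[OF in_layer] by (elim disjE) (metis (no_types))+
qed

end

lemma mutually_reachable_twin_classes_minus_cover:
  assumes "double_clique_cover twin_adj I K B" and "card I \<le> 2 * k + 1"
  shows "mutually_reachable twin_adj (twin_classes k - B)"
  using assms
proof (induction k arbitrary: I K B)
  case 0
  then have "B = {}" by (intro double_clique_cover.covered_empty) auto
  have "(u, v) \<in> (Restr twin_adj (twin_classes 0))\<^sup>*"
    if "u \<in> twin_classes 0" "v \<in> twin_classes 0" for u v
    using that by (cases "u = v") (auto simp: twin_adj_def twin_classes_def)
  then show ?case by (simp add: \<open>B = {}\<close> mutually_reachable_def)
next
  case (Suc k)
  interpret double_clique_cover twin_adj I K B by fact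
  interpret layered_double_cover I K B k
  proof
    show "card I \<le> 2 * k + 3" using Suc.prems(2) by simp
    fix c assume "card (meeting (layer c)) \<le> 2 * k + 1"
    moreover have "double_clique_cover twin_adj (meeting (layer c))
        (\<lambda>i. apsnd ((#) c) -` K i) (apsnd ((#) c) -` B)"
      unfolding layer_eq_range by (rule double_clique_cover_vimage) (auto simp: inj_def)
    ultimately show "mutually_reachable twin_adj (twin_classes k - apsnd ((#) c) -` B)"
      by (intro Suc.IH)
  qed
  have "mutually_reachable twin_adj unblocked"
    using mutually_reachable_if_crowded mutually_reachable_if_spread by blast
  then show ?case by (simp add: unblocked_def)
qed


subsection \<open>Removing cliques from the balanced hypercube\<close>

definition twin_class :: "int list \<Rightarrow> twin_class" where
  "twin_class u = (even (hd u), map of_int (tl u))"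

lemma twin_class_Cons [simp]: "twin_class (a # x) = (even a, map of_int x)"
  by (simp add: twin_class_def)

lemma bij_betw_of_int_Z4: "bij_betw of_int {0, 1, 2, 3} (UNIV :: 4 set)"
  using exhaust_Z4 by (auto simp: bij_betw_def inj_on_def)

lemma of_int_mod_Z4: "(of_int (z mod 4) :: 4) = of_int z"
  by (simp add: bit0.of_int_eq)

lemma bij_betw_BH_verts: "bij_betw (map of_int) (BH_verts k) {x :: 4 list. length x = k}"
proof -
  have bij: "bij_betw (map of_int) (lists {0, 1, 2, 3}) (lists (UNIV :: 4 set))"
    by (rule bij_lists[OF bij_betw_of_int_Z4])
  have verts: "BH_verts k = {x \<in> lists {0, 1, 2, 3}. length x = k}"
    by (auto simp: BH_verts_def lists_eq_set)
  show ?thesis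
    unfolding bij_betw_def
  proof (intro conjI equalityI subsetI)
    show "inj_on (map of_int :: _ \<Rightarrow> 4 list) (BH_verts k)"
      using bij_betw_imp_inj_on[OF bij] unfolding verts by (rule inj_on_subset) blast
    fix x :: "4 list" assume "x \<in> {x. length x = k}"
    moreover obtain z where "z \<in> lists {0, 1, 2, 3}" "x = map of_int z"
      using bij_betw_imp_surj_on[OF bij] by (metis imageE lists_UNIV UNIV_I)
    ultimately show "x \<in> map of_int ` BH_verts k" by (simp add: verts)
  qed (auto simp: verts)
qed

lemma BH_verts_Cons [simp]:
  "a # x \<in> BH_verts (Suc k) \<longleftrightarrow> a \<in> {0, 1, 2, 3} \<and> x \<in> BH_verts k"
  by (auto simp: BH_verts_def)

lemma BH_verts_SucE:
  assumes "u \<in> BH_verts (Suc k)"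
  obtains a x where "u = a # x" "a \<in> {0, 1, 2, 3}" "x \<in> BH_verts k"
  using assms by (cases u) (auto simp: BH_verts_def)

lemma finite_BH_verts: "finite (BH_verts k)"
  using finite_lists_length_eq[of "{0, 1, 2, 3 :: int}" k] by (simp add: BH_verts_def conj_commute)

lemma twin_class_in_twin_classes: "u \<in> BH_verts (Suc k) \<Longrightarrow> twin_class u \<in> twin_classes k"
  by (auto simp: BH_verts_def twin_class_def)

lemma ex_twins:
  assumes "C \<in> twin_classes k"
  obtains u v where "u \<in> BH_verts (Suc k)" "v \<in> BH_verts (Suc k)" "u \<noteq> v"
    "twin_class u = C" "twin_class v = C"
proof -
  obtain p x where C_eq: "C = (p, x)" "length x = k"
    using assms by (auto simp: twin_classes_def)
  then obtain y where lift: "y \<in> BH_verts k" "x = map of_int y"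
    using bij_betw_imp_surj_on[OF bij_betw_BH_verts[of k]] by blast
  show ?thesis
    using that[of "0 # y" "2 # y"] that[of "1 # y" "3 # y"] lift C_eq by (cases p) auto
qed

lemma lazy_step_iff_update:
  "lazy_step p x y \<longleftrightarrow> y = x \<or> (\<exists>i<length x. y = x[i := shift p (x ! i)])"
proof (induction x arbitrary: y)
  case (Cons c x)
  have "(\<exists>i<length (c # x). y = (c # x)[i := shift p ((c # x) ! i)]) \<longleftrightarrow>
      y = shift p c # x \<or> (\<exists>i<length x. y = c # x[i := shift p (x ! i)])"
    by (simp only: length_Cons Ex_less_Suc2) simp
  then show ?case using Cons.IH by auto
qed simp

lemma parity_neighbours_mod_4:
  fixes a b :: int
  assumes "a \<in> {0, 1, 2, 3}"
  shows "(\<exists>s\<in>{1, -1}. b = (a + s) mod 4) \<longleftrightarrow> b \<in> {0, 1, 2, 3} \<and> even a \<noteq> even b"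
  using assms by (elim insertE emptyE) auto

lemma map_of_int_update_shift:
  assumes "i < length x" "a \<in> {0, 1, 2, 3}"
  shows "map of_int (x[i := (x ! i + (- 1) ^ nat a) mod 4]) =
    (map of_int x)[i := shift (even a) (map of_int x ! i)]"
  using assms by (auto simp: map_update of_int_mod_Z4 shift_def)

lemma BH_verts_update_mod:
  assumes "x \<in> BH_verts k"
  shows "x[i := z mod 4] \<in> BH_verts k"
proof -
  have "z mod 4 \<in> {0, 1, 2, 3}" by (simp; presburger)
  then show ?thesis
    using assms set_update_subset_insert[of x i "z mod 4"] by (auto simp: BH_verts_def)
qed

lemma BH_update_iff_lazy_step:
  assumes x: "x \<in> BH_verts k" and a: "a \<in> {0, 1, 2, 3}"
  shows "y = x \<or> (\<exists>i<k. y = x[i := (x ! i + (- 1) ^ nat a) mod 4]) \<longleftrightarrow>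
    y \<in> BH_verts k \<and> lazy_step (even a) (map of_int x) (map of_int y)"
proof -
  have length_x: "length x = k" using x by (simp add: BH_verts_def)
  have eq_iff: "y = z \<longleftrightarrow> y \<in> BH_verts k \<and> map of_int y = (map of_int z :: 4 list)"
    if "z \<in> BH_verts k" for z
    using that bij_betw_imp_inj_on[OF bij_betw_BH_verts] by (auto dest: inj_onD)
  have "y = x[i := (x ! i + (- 1) ^ nat a) mod 4] \<longleftrightarrow> y \<in> BH_verts k \<and>
      map of_int y = (map of_int x)[i := shift (even a) (map of_int x ! i)]" if "i < k" for i
    using eq_iff[OF BH_verts_update_mod[OF x]] map_of_int_update_shift[OF _ a] that length_x
    by simp
  then show ?thesis
    unfolding lazy_step_iff_update length_map length_x eq_iff[OF x] by blast
qed

lemma BH_nbrs_Cons: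
  assumes "length x = k"
  shows "v \<in> BH_nbrs (Suc k) (a # x) \<longleftrightarrow> (\<exists>s\<in>{1, -1}. \<exists>y. v = (a + s) mod 4 # y \<and>
    (y = x \<or> (\<exists>i<k. y = x[i := (x ! i + (- 1) ^ nat a) mod 4])))"
proof -
  have index: "(\<exists>i. 1 \<le> i \<and> i \<le> k \<and> P i) \<longleftrightarrow> (\<exists>j<k. P (Suc j))" for P
    by (metis Suc_le_D Suc_le_eq Suc_le_mono One_nat_def le_add1 plus_1_eq_Suc)
  have "v \<in> BH_nbrs (Suc k) (a # x) \<longleftrightarrow> (\<exists>s\<in>{1, -1}. v = (a + s) mod 4 # x \<or>
      (\<exists>i. 1 \<le> i \<and> i \<le> k \<and>
        v = ((a + s) mod 4 # x)[i := ((a # x) ! i + (- 1) ^ nat a) mod 4]))"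
    unfolding BH_nbrs_def nth_Cons_0 list_update_code diff_Suc_1 by blast
  then show ?thesis unfolding index by auto
qed

lemma BH_nbrs_iff:
  assumes "u \<in> BH_verts (Suc k)"
  shows "v \<in> BH_nbrs (Suc k) u \<longleftrightarrow>
    v \<in> BH_verts (Suc k) \<and> (twin_class u, twin_class v) \<in> twin_adj"
proof -
  obtain a x where u_eq: "u = a # x" and a: "a \<in> {0, 1, 2, 3}" and x: "x \<in> BH_verts k"
    using assms by (rule BH_verts_SucE)
  have length_x: "length x = k" using x by (simp add: BH_verts_def)
  have "v \<in> BH_nbrs (Suc k) u \<longleftrightarrow> (\<exists>b y. v = b # y \<and> (\<exists>s\<in>{1, -1}. b = (a + s) mod 4) \<and>
      y \<in> BH_verts k \<and> lazy_step (even a) (map of_int x) (map of_int y))"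
    unfolding u_eq BH_nbrs_Cons[OF length_x] BH_update_iff_lazy_step[OF x a] by blast
  also have "\<dots> \<longleftrightarrow> v \<in> BH_verts (Suc k) \<and> (twin_class u, twin_class v) \<in> twin_adj"
    unfolding parity_neighbours_mod_4[OF a]
    by (cases v) (auto simp: u_eq twin_adj_def BH_verts_def)
  finally show ?thesis .
qed

lemma pverts_BH: "pverts (BH n) = BH_verts n"
  by (simp add: BH_def)

lemma parcs_BH: "parcs (BH (Suc k)) =
  {(u, v). u \<in> BH_verts (Suc k) \<and> v \<in> BH_verts (Suc k) \<and> (twin_class u, twin_class v) \<in> twin_adj}"
  using BH_nbrs_iff by (auto simp: BH_def)

lemma graph_BH: "graph (with_proj (BH (Suc k)))"
proof -
  interpret pair_graph "BH (Suc k)"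
  proof
    show "finite (parcs (BH (Suc k)))"
      by (rule finite_subset[of _ "BH_verts (Suc k) \<times> BH_verts (Suc k)"])
        (auto simp: parcs_BH finite_BH_verts)
    show "symmetric (with_proj (BH (Suc k)))"
      using sym_twin_adj by (auto simp: symmetric_def parcs_BH intro!: symI dest: symD)
  qed (auto simp: pverts_BH parcs_BH finite_BH_verts twin_class_def)
  show ?thesis by unfold_locales
qed

locale removed_cliques =
  fixes k :: nat and I :: "'i set" and V :: "'i \<Rightarrow> int list set"
  assumes finite_removed: "finite I" and card_removed_le: "card I \<le> 2 * k + 1"
    and removed_clique: "\<lbrakk>i \<in> I; u \<in> V i; v \<in> V i; u \<noteq> v\<rbrakk> \<Longrightarrow>
      (twin_class u, twin_class v) \<in> twin_adj"
begin

definition surviving :: "int list set" where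
  "surviving = BH_verts (Suc k) - (\<Union>i\<in>I. V i)"

definition removed_classes :: "twin_class set" where
  "removed_classes = {C \<in> twin_classes k. \<forall>u\<in>surviving. twin_class u \<noteq> C}"

lemma surviving_class: "u \<in> surviving \<Longrightarrow> twin_class u \<in> twin_classes k - removed_classes"
  using twin_class_in_twin_classes by (auto simp: removed_classes_def surviving_def)

lemma ex_surviving: "C \<in> twin_classes k - removed_classes \<Longrightarrow> \<exists>u\<in>surviving. twin_class u = C"
  by (auto simp: removed_classes_def)

sublocale double_clique_cover twin_adj I "\<lambda>i. twin_class ` V i" removed_classes
proof
  show "finite I" by (rule finite_removed)
  show "(C, D) \<in> twin_adj"
    if "i \<in> I" "C \<in> twin_class ` V i" "D \<in> twin_class ` V i" "C \<noteq> D" for i C D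
    using that removed_clique by blast
  show "2 \<le> card {i \<in> I. C \<in> twin_class ` V i}" if removed: "C \<in> removed_classes" for C
  proof -
    have "C \<in> twin_classes k" using removed by (simp add: removed_classes_def)
    then obtain u v where "u \<in> BH_verts (Suc k)" "v \<in> BH_verts (Suc k)"
      and twins: "u \<noteq> v" "twin_class u = C" "twin_class v = C"
      by (rule ex_twins)
    moreover from this have "u \<notin> surviving" "v \<notin> surviving"
      using removed by (auto simp: removed_classes_def)
    ultimately obtain i j where covers: "i \<in> I" "u \<in> V i" "j \<in> I" "v \<in> V j"
      by (auto simp: surviving_def)
    have "i \<noteq> j" using removed_clique[of i u v] twins covers by auto
    have "{i, j} \<subseteq> {i \<in> I. C \<in> twin_class ` V i}"
      using covers imageI[OF covers(2), of twin_class] imageI[OF covers(4), of twin_class] twins by simp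
    have "2 = card {i, j}" using \<open>i \<noteq> j\<close> by simp
    also have "\<dots> \<le> card {i \<in> I. C \<in> twin_class ` V i}"
      using finite_removed \<open>{i, j} \<subseteq> _\<close> by (intro card_mono) simp_all
    finally show ?thesis .
  qed
qed

lemma ex_surviving_neighbour_class:
  assumes "C \<in> twin_classes k"
  obtains D where "(C, D) \<in> twin_adj" "D \<in> twin_classes k - removed_classes"
proof -
  obtain p x where C_eq: "C = (p, x)" "length x = k" using assms by (auto simp: twin_classes_def)
  let ?N = "Pair (\<not> p) ` {y. lazy_step p x y}"
  have "\<not> ?N \<subseteq> removed_classes"
  proof
    assume "?N \<subseteq> removed_classes"
    then have "2 * card ?N \<le> card (meeting ?N)" by (rule card_independent_le) auto
    also have "\<dots> \<le> 2 * k + 1" using card_meeting_le card_removed_le by (rule le_trans)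
    finally show False using C_eq(2) by (simp add: card_image inj_on_def)
  qed
  then obtain y where "lazy_step p x y" "(\<not> p, y) \<notin> removed_classes" by blast
  then show ?thesis
    using that[of "(\<not> p, y)"] length_lazy_step C_eq by (auto simp: twin_adj_def)
qed

abbreviation remainder :: "(int list, int list \<times> int list) pre_digraph" where
  "remainder \<equiv> with_proj (BH (Suc k)) \<restriction> surviving"

lemma dominates_remainder:
  "u \<rightarrow>\<^bsub>remainder\<^esub> v \<longleftrightarrow>
     u \<in> surviving \<and> v \<in> surviving \<and> (twin_class u, twin_class v) \<in> twin_adj"
  by (force simp: arcs_ends_conv induce_subgraph_def parcs_BH surviving_def)

lemma reachable_remainder:
  assumes "u \<in> surviving" and "v \<in> surviving"
  shows "u \<rightarrow>\<^sup>*\<^bsub>remainder\<^esub> v"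
proof -
  interpret G: graph "with_proj (BH (Suc k))" by (rule graph_BH)
  interpret R: wf_digraph remainder by (rule G.wellformed_induce_subgraph)
  let ?S = "twin_classes k - removed_classes"
  have "w \<in> surviving \<Longrightarrow> twin_class w = D \<Longrightarrow> u \<rightarrow>\<^sup>*\<^bsub>remainder\<^esub> w"
    if "(twin_class u, D) \<in> (Restr twin_adj ?S)\<^sup>*" for w D
    using that
  proof (induction arbitrary: w rule: rtrancl_induct)
    case base
    obtain D where "(twin_class u, D) \<in> twin_adj" "D \<in> ?S"
      using ex_surviving_neighbour_class surviving_class[OF assms(1)] by blast
    moreover from this obtain u' where "u' \<in> surviving" "twin_class u' = D"
      using ex_surviving by blast
    ultimately have "u \<rightarrow>\<^bsub>remainder\<^esub> u'" "u' \<rightarrow>\<^bsub>remainder\<^esub> w"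
      using base assms(1) symD[OF sym_twin_adj] by (auto simp: dominates_remainder)
    then show ?case by (meson R.adj_reachable_trans R.reachable_adjI)
  next
    case (step C D)
    then obtain w' where predecessor: "w' \<in> surviving" "twin_class w' = C"
      using ex_surviving by blast
    then have "u \<rightarrow>\<^sup>*\<^bsub>remainder\<^esub> w'" by (rule step.IH)
    moreover have "w' \<rightarrow>\<^bsub>remainder\<^esub> w"
      using predecessor step by (auto simp: dominates_remainder)
    ultimately show ?case by (rule R.reachable_adj_trans)
  qed
  moreover have "(twin_class u, twin_class v) \<in> (Restr twin_adj ?S)\<^sup>*"
    using mutually_reachable_twin_classes_minus_cover[OF double_clique_cover_axioms card_removed_le]
      surviving_class assms unfolding mutually_reachable_def by blast
  ultimately show ?thesis using assms(2) by blast
qed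

lemma connected_remainder: "connected remainder"
proof -
  interpret G: graph "with_proj (BH (Suc k))" by (rule graph_BH)
  interpret R: wf_digraph remainder by (rule G.wellformed_induce_subgraph)
  have sym: "symmetric remainder"
    using sym_twin_adj by (auto simp: symmetric_def dominates_remainder intro!: symI dest: symD)
  have "(True, replicate k 0) \<in> twin_classes k" by simp
  then obtain C where "C \<in> twin_classes k - removed_classes"
    by (rule ex_surviving_neighbour_class)
  then have "verts remainder \<noteq> {}" using ex_surviving[of C] by auto
  then show ?thesis
    using reachable_remainder by (intro R.connectedI) (simp_all add: R.reachable_mk_symmetric_eq[OF sym])
qed

lemma verts_remainder_not_singleton: "verts remainder \<noteq> {v}"
proof
  assume singleton: "verts remainder = {v}"
  then have "twin_class v \<in> twin_classes k" using surviving_class by auto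
  then obtain D where "(twin_class v, D) \<in> twin_adj" "D \<in> twin_classes k - removed_classes"
    by (rule ex_surviving_neighbour_class)
  moreover from this obtain u where "u \<in> surviving" "twin_class u = D"
    using ex_surviving by blast
  moreover from this have "u = v" using singleton by simp
  ultimately show False by auto
qed

end

lemma digraph_iso_card_verts: "digraph_iso K L \<Longrightarrow> card (verts K) = card (verts L)"
  by (auto simp: digraph_iso_def pre_digraph.digraph_isomorphism_def card_image)

lemma card_verts_K11: "K\<^bsub>1,1\<^esub> H \<Longrightarrow> card (verts H) = 2"
  by (auto simp: complete_bipartite_digraph_def card_Un_disjoint card_ge_0_finite)

lemma connected_graph_card_2_adj:
  assumes "graph G" "connected G" "card (verts G) \<le> 2" "u \<in> verts G" "v \<in> verts G" "u \<noteq> v"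
  shows "u \<rightarrow>\<^bsub>G\<^esub> v"
proof -
  interpret graph G by fact
  have "strongly_connected G"
    using symmetric_connected_imp_strongly_connected[OF sym_arcs assms(2)] .
  then obtain w where arc: "u \<rightarrow>\<^bsub>G\<^esub> w"
    using assms(4-6) by (metis converse_reachable_cases strongly_connectedE)
  have "{u, v} = verts G"
    using assms by (intro card_seteq) auto
  moreover have "w \<in> verts G" "w \<noteq> u" using arc adj_in_verts adj_not_same by auto
  ultimately have "w = v" by auto
  with arc show ?thesis by simp
qed

lemma card_substructure_cut_BH_ge:
  assumes "graph H" "card (verts H) \<le> 2"
    and "finite F" "substructure_cut (with_proj (BH (Suc k))) H F"
  shows "2 * Suc k \<le> card F"
proof (rule ccontr)
  assume few: "\<not> ?thesis"
  have "(twin_class u, twin_class v) \<in> twin_adj"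
    if "K \<in> F" "u \<in> verts K" "v \<in> verts K" "u \<noteq> v" for K u v
  proof -
    obtain L where iso: "connected_subgraph L H" "digraph_iso K L"
      and subgraph: "connected_subgraph K (with_proj (BH (Suc k)))"
      using assms(4) \<open>K \<in> F\<close> by (auto simp: substructure_cut_def subgraph_cut_def)
    interpret H: graph H by fact
    have "card (verts K) \<le> card (verts H)"
      using digraph_iso_card_verts[OF iso(2)] iso(1) H.finite_verts
      by (auto simp: connected_subgraph_def subgraph_def intro: card_mono)
    then have "u \<rightarrow>\<^bsub>K\<^esub> v"
      using subgraph that assms(2) by (intro connected_graph_card_2_adj) (auto simp: connected_subgraph_def)
    then have "u \<rightarrow>\<^bsub>with_proj (BH (Suc k))\<^esub> v"
      using subgraph arcs_ends_mono unfolding connected_subgraph_def by blast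
    then show ?thesis by (simp add: parcs_BH)
  qed
  then interpret removed_cliques k F verts
    using few assms(3) by unfold_locales auto
  have "\<not> connected remainder \<or> (\<exists>v. verts remainder = {v})"
    using assms(4) by (simp add: substructure_cut_def subgraph_cut_def Let_def surviving_def pverts_BH)
  then show False
    using connected_remainder verts_remainder_not_singleton by blast
qed


subsection \<open>Separating a vertex by its neighbourhood\<close>

lemma connected_subgraph_induced_singleton:
  assumes "graph G" "v \<in> verts G"
  shows "connected_subgraph (G \<restriction> {v}) G"
proof -
  interpret graph G by fact
  have induced: "induced_subgraph (G \<restriction> {v}) G" using assms(2) by auto
  then have "graph (G \<restriction> {v})"
    by (intro digraph.graphI digraphI_induced induced_graph_imp_symmetric[OF sym_arcs])
  moreover have "connected (G \<restriction> {v})" by (simp add: connected_conv)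
  ultimately show ?thesis
    using induced_imp_subgraph[OF induced] by (simp add: connected_subgraph_def)
qed

lemma digraph_iso_induced_singletons:
  assumes "graph G" "graph H"
  shows "digraph_iso (G \<restriction> {v}) (H \<restriction> {w})"
  unfolding digraph_iso_def
proof (intro exI conjI)
  interpret G: graph G by fact
  interpret H: graph H by fact
  let ?f = "\<lparr>iso_verts = \<lambda>_. w, iso_arcs = undefined, iso_head = head H, iso_tail = tail H\<rparr>"
  have no_arcs: "arcs (G \<restriction> {v}) = {}" "arcs (H \<restriction> {w}) = {}"
    by (auto dest: G.no_loops H.no_loops)
  show "pre_digraph.digraph_isomorphism (G \<restriction> {v}) ?f"
    unfolding pre_digraph.digraph_isomorphism_def no_arcs
    using G.wellformed_induce_subgraph by simp
  show "H \<restriction> {w} = app_iso ?f (G \<restriction> {v})"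
    by (rule pre_digraph.equality) (simp_all add: no_arcs del: induce_subgraph_arcs)
qed

lemma not_connected_without_neighbourhood:
  assumes "graph G" "v \<in> verts G" "w \<in> verts G" "v \<noteq> w" "\<not> v \<rightarrow>\<^bsub>G\<^esub> w"
  shows "\<not> connected (G \<restriction> (verts G - {x. v \<rightarrow>\<^bsub>G\<^esub> x}))" (is "\<not> connected ?R")
proof
  interpret graph G by fact
  interpret R: wf_digraph ?R by (rule wellformed_induce_subgraph)
  assume "connected ?R"
  moreover have "induced_subgraph ?R G" by (rule induced_induce) blast
  then have "symmetric ?R" by (rule induced_graph_imp_symmetric[OF sym_arcs])
  ultimately have "strongly_connected ?R"
    by (intro R.symmetric_connected_imp_strongly_connected)
  moreover have "v \<in> verts ?R" "w \<in> verts ?R"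
    using assms(2-) adj_not_same by auto
  ultimately have "v \<rightarrow>\<^sup>*\<^bsub>?R\<^esub> w" by blast
  then obtain x where "v \<rightarrow>\<^bsub>?R\<^esub> x"
    using \<open>v \<noteq> w\<close> by (cases rule: R.converse_reachable_cases) auto
  then have "x \<in> verts ?R" "v \<rightarrow>\<^bsub>G\<^esub> x"
    using R.adj_in_verts dominates_induce_subgraphD by fast+
  then show False by simp
qed

lemma substructure_cut_neighbourhood:
  assumes "graph G" "graph H" "verts H \<noteq> {}"
    and "v \<in> verts G" "w \<in> verts G" "v \<noteq> w" "\<not> v \<rightarrow>\<^bsub>G\<^esub> w"
  shows "substructure_cut G H ((\<lambda>x. G \<restriction> {x}) ` {x. v \<rightarrow>\<^bsub>G\<^esub> x})" (is "substructure_cut G H ?F")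
proof -
  interpret graph G by fact
  obtain h where "h \<in> verts H" using assms(3) by blast
  then have "\<exists>L. connected_subgraph L H \<and> digraph_iso K L" if "K \<in> ?F" for K
    using that connected_subgraph_induced_singleton[OF assms(2)]
      digraph_iso_induced_singletons[OF assms(1,2)] by blast
  moreover have "connected_subgraph K G" if "K \<in> ?F" for K
    using that connected_subgraph_induced_singleton[OF assms(1)] adj_in_verts by fast
  moreover have "(\<Union>K\<in>?F. verts K) = {x. v \<rightarrow>\<^bsub>G\<^esub> x}" by simp
  ultimately show ?thesis
    using not_connected_without_neighbourhood[OF assms(1,4-)]
    unfolding substructure_cut_def subgraph_cut_def Let_def by simp
qed

lemma substructure_connectivity_le_degree:
  assumes "graph G" "graph H" "verts H \<noteq> {}"
    and "v \<in> verts G" "w \<in> verts G" "v \<noteq> w" "\<not> v \<rightarrow>\<^bsub>G\<^esub> w"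
  shows "\<kappa>\<^sup>s G H \<le> enat (card {x. v \<rightarrow>\<^bsub>G\<^esub> x})"
proof -
  interpret graph G by fact
  let ?N = "{x. v \<rightarrow>\<^bsub>G\<^esub> x}"
  let ?F = "(\<lambda>x. G \<restriction> {x}) ` ?N"
  have "finite ?N"
    by (rule finite_subset[OF _ finite_verts]) (auto simp: adj_in_verts)
  then have "finite ?F" "card ?F \<le> card ?N" by (auto intro: card_image_le)
  moreover have "substructure_cut G H ?F"
    using assms by (rule substructure_cut_neighbourhood)
  ultimately have "\<kappa>\<^sup>s G H \<le> enat (card ?F)"
    unfolding substructure_connectivity_def by (intro Inf_lower) auto
  also have "\<dots> \<le> enat (card ?N)" using \<open>card ?F \<le> card ?N\<close> by simp
  finally show ?thesis .
qed

lemma degree_BH_le: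
  assumes "n \<ge> 1"
  shows "card {v. u \<rightarrow>\<^bsub>with_proj (BH n)\<^esub> v} \<le> 2 * n"
proof -
  define nbr where "nbr = (\<lambda>(s, i). if i = 0 then u[0 := (u ! 0 + s) mod 4]
    else u[0 := (u ! 0 + s) mod 4, i := (u ! i + (-1) ^ nat (u ! 0)) mod 4])"
  let ?P = "{1, -1 :: int} \<times> {..<n}"
  have "{v. u \<rightarrow>\<^bsub>with_proj (BH n)\<^esub> v} \<subseteq> nbr ` ?P"
  proof
    fix v assume "v \<in> {v. u \<rightarrow>\<^bsub>with_proj (BH n)\<^esub> v}"
    then consider s where "s \<in> {1, -1}" "v = nbr (s, 0)"
      | s i where "s \<in> {1, -1}" "1 \<le> i" "i \<le> n - 1" "v = nbr (s, i)"
      by (auto simp: BH_def BH_nbrs_def nbr_def)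
    then show "v \<in> nbr ` ?P" using assms by cases auto
  qed
  then have "card {v. u \<rightarrow>\<^bsub>with_proj (BH n)\<^esub> v} \<le> card ?P"
    by (rule surj_card_le[rotated]) simp
  then show ?thesis by (simp add: card_cartesian_product)
qed

theorem theorem2:
  fixes n :: nat and H :: "('a, 'b) pre_digraph"
  assumes "n \<ge> 2" and "K\<^bsub>1,1\<^esub> H"
  shows "\<kappa>\<^sup>s (with_proj (BH n)) H = enat (2 * n)"
proof (rule antisym)
  obtain k where n: "n = Suc k" using assms(1) by (cases n) auto
  have single_edge: "graph H" "card (verts H) = 2" "verts H \<noteq> {}"
    using assms(2) card_verts_K11 by (fastforce simp: complete_bipartite_digraph_def)+
  then show "enat (2 * n) \<le> \<kappa>\<^sup>s (with_proj (BH n)) H"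
    using card_substructure_cut_BH_ge[of H] unfolding n substructure_connectivity_def
    by (intro Inf_greatest) auto
  let ?u = "0 # replicate k 0" and ?v = "2 # replicate k 0"
  have "?u \<in> BH_verts (Suc k)" "?v \<in> BH_verts (Suc k)" by (auto simp: BH_verts_def)
  then have "\<kappa>\<^sup>s (with_proj (BH n)) H \<le> enat (card {v. ?u \<rightarrow>\<^bsub>with_proj (BH n)\<^esub> v})"
    unfolding n using graph_BH single_edge
    by (intro substructure_connectivity_le_degree[where w = ?v]) (auto simp: pverts_BH parcs_BH)
  also have "\<dots> \<le> enat (2 * n)"
    using degree_BH_le[of n ?u] by (simp add: n)
  finally show "\<kappa>\<^sup>s (with_proj (BH n)) H \<le> enat (2 * n)" .
qed

end
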